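(* Let $n\ge4$ be an even integer, $\ell\ge0$ an integer, and let $\mathfrak g$ be of type $D_n^{(1)}$. Let $$\upsilon_1=(0,n)(1,n-1),\qquad \upsilon_2=(0,1)(2,3)\cdots(n-4,n-3)(n-1,n)$$ in $\mathfrak S_{\{0,\dots,n\}}$; they commute. Let $C_2=\langle\sigma_2\rangle$ be the group of order $2$ with identity $e$, and let $C_2\times C_2$ act on the set $P^+_{\mathrm{cl},\ell}$ of classical dominant integral weights of level $\ell$ by $$(\sigma_2,e)\cdot\sum_{i=0}^n m_i\Lambda_i=\sum_{i=0}^n m_{\upsilon_1(i)}\Lambda_i,\qquad (e,\sigma_2)\cdot\sum_{i=0}^n m_i\Lambda_i=\sum_{i=0}^n m_{\upsilon_2(i)}\Lambda_i .$$ Let $$P^+_{\mathrm{cl},\ell}(q_1,q_2)=\sum_{\sum_i m_i\Lambda_i\in P^+_{\mathrm{cl},\ell}} q_1^{\,m_{n-1}+m_n}\,q_2^{\,m_1+m_3+\cdots+m_{n-1}} .$$ Then the triple $\bigl(P^+_{\mathrm{cl},\ell},\,C_2\times C_2,\,P^+_{\mathrm{cl},\ell}(q_1,q_2)\bigr)$ exhibits the bicyclic sieving phenomenon.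
   Context: For type $D_n^{(1)}$ the canonical central element is $c=\sum_{i=0}^n a_i^\vee h_i$ with $(a_0^\vee,\dots,a_n^\vee)=(1,1,2,2,\dots,2,1,1)$ (with $n-3$ twos, in positions $2,\dots,n-2$). Classical dominant integral weights of level $\ell$ (dominant integral weights of level $\ell$ modulo $\mathbb Z\delta$) are identified with $P^+_{\mathrm{cl},\ell}=\{\sum_{i=0}^n m_i\Lambda_i: m_i\in\mathbb Z_{\ge0},\ \sum_{i=0}^n a_i^\vee m_i=\ell\}$. Bicyclic sieving phenomenon: let $X$ be a finite set with an action of $C_k\times C_{k'}$ (cyclic groups of orders $k,k'$), fix embeddings $\omega:C_k\to\mathbb C^\times$ and $\omega':C_{k'}\to\mathbb C^\times$, and let $X(q_1,q_2)$ be a polynomial with nonnegative integer coefficients. The triple $(X,C_k\times C_{k'},X(q_1,q_2))$ exhibits the bicyclic sieving phenomenon if for all $(g,g')\in C_k\times C_{k'}$ one has $X(\omega(g),\omega'(g'))=|\{x\in X:(g,g')x=x\}|$. (For $k=k'=2$ the embeddings are unique, sending $\sigma_2\mapsto -1$.) *)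

theory Defs
  imports
    "HOL-Algebra.Group_Action"
    "HOL-Algebra.Elementary_Groups"
    "HOL-Combinatorics.Permutations"
    "HOL-Computational_Algebra.Polynomial"
    Complex_Main
begin

section \<open>Bicyclic sieving\<close>

definition complex_units :: "complex monoid" where
  "complex_units = \<lparr>carrier = UNIV - {0}, monoid.mult = (*), one = 1\<rparr>"

text \<open>A polynomial in \<open>q\<^sub>1\<close>, \<open>q\<^sub>2\<close> with nonnegative integer coefficients is an element of
  \<^typ>\<open>nat poly poly\<close>; the inner variable is \<open>q\<^sub>1\<close> and the outer one is \<open>q\<^sub>2\<close>.\<close>

definition poly2 :: "nat poly poly \<Rightarrow> complex \<Rightarrow> complex \<Rightarrow> complex" where
  "poly2 P x y = poly (map_poly (\<lambda>p. poly (map_poly of_nat p) x) P) y"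

text \<open>In HOL-Algebra, \<^const>\<open>mon\<close> is the set of injective homomorphisms, and
  \<^const>\<open>group_action\<close> requires \<open>\<phi> g\<close> to be a bijection of \<open>X\<close> that is
  \<^const>\<open>undefined\<close> outside \<open>X\<close>.\<close>

definition bicyclic_sieving ::
  "('a, 'c) monoid_scheme \<Rightarrow> ('b, 'd) monoid_scheme \<Rightarrow> ('a \<Rightarrow> complex) \<Rightarrow> ('b \<Rightarrow> complex)
    \<Rightarrow> 'x set \<Rightarrow> ('a \<times> 'b \<Rightarrow> 'x \<Rightarrow> 'x) \<Rightarrow> nat poly poly \<Rightarrow> bool" where
  "bicyclic_sieving G H \<omega> \<omega>' X \<phi> P \<longleftrightarrow>
     group G \<and> cyclic_group G \<and> finite (carrier G) \<and>
     group H \<and> cyclic_group H \<and> finite (carrier H) \<and>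
     \<omega> \<in> mon G complex_units \<and> \<omega>' \<in> mon H complex_units \<and>
     finite X \<and> group_action (G \<times>\<times> H) X \<phi> \<and>
     (\<forall>g\<in>carrier G. \<forall>h\<in>carrier H.
        poly2 P (\<omega> g) (\<omega>' h) = of_nat (card (invariants X \<phi> (g, h))))"

text \<open>The cyclic group of order 2 is \<^term>\<open>integer_mod_group 2\<close>, with carrier \<open>{0, 1}\<close>
  and generator \<open>\<sigma>\<^sub>2 = 1\<close>.\<close>

definition C2_embedding :: "int \<Rightarrow> complex" where
  "C2_embedding a = (if a = 0 then 1 else -1)"

lemma carrier_C2: "carrier (integer_mod_group 2) = {0, 1}"
  by (auto simp: carrier_integer_mod_group)

lemma C2_embedding_unique:
  assumes "\<omega> \<in> mon (integer_mod_group 2) complex_units"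
    and "a \<in> carrier (integer_mod_group 2)"
  shows "\<omega> a = C2_embedding a"
proof -
  have hom: "\<And>x y. x \<in> {0, 1} \<Longrightarrow> y \<in> {0, 1} \<Longrightarrow> \<omega> ((x + y) mod 2) = \<omega> x * \<omega> y"
    and nz: "\<And>x. x \<in> {0, 1} \<Longrightarrow> \<omega> x \<noteq> 0" and inj: "inj_on \<omega> {0, 1}"
    using assms(1) unfolding mon_def hom_def carrier_C2
    by (auto simp: complex_units_def integer_mod_group_def Pi_iff)
  have 0: "\<omega> 0 = 1" using hom[of 0 0] nz[of 0] by simp
  have "\<omega> 1 * \<omega> 1 = 1" using hom[of 1 1] 0 by simp
  moreover have "\<omega> 1 \<noteq> 1" using inj 0 by (auto simp: inj_on_def)
  ultimately have "\<omega> 1 = -1" by (simp add: square_eq_1_iff)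
  then show ?thesis using 0 assms(2) by (auto simp: carrier_C2 C2_embedding_def)
qed

section \<open>Dominant weights of type \<open>D\<^sub>n\<^sup>(\<^sup>1\<^sup>)\<close>\<close>

definition comark :: "nat \<Rightarrow> nat \<Rightarrow> nat" where
  "comark n i = (if i \<in> {0, 1, n - 1, n} then 1 else 2)"

text \<open>The weight \<open>\<Sum>\<^sub>i m\<^sub>i \<Lambda>\<^sub>i\<close> is encoded by its coefficients \<open>m :: nat \<Rightarrow> nat\<close>, set
  to 0 beyond index \<open>n\<close>.\<close>

definition P_cl :: "nat \<Rightarrow> nat \<Rightarrow> (nat \<Rightarrow> nat) set" where
  "P_cl n l = {m. (\<forall>i>n. m i = 0) \<and> (\<Sum>i=0..n. comark n i * m i) = l}"

definition upsilon1 :: "nat \<Rightarrow> nat \<Rightarrow> nat" where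
  "upsilon1 n = transpose 0 n \<circ> transpose 1 (n - 1)"

text \<open>The factors of the fold are \<open>(0,1), (2,3), \<dots>, (n-4,n-3)\<close>, for even \<open>n\<close>.\<close>

definition upsilon2 :: "nat \<Rightarrow> nat \<Rightarrow> nat" where
  "upsilon2 n =
     foldr (\<lambda>j p. transpose (2 * j) (2 * j + 1) \<circ> p) [0..<(n - 2) div 2] (transpose (n - 1) n)"

text \<open>The coefficient of \<open>\<Lambda>\<^sub>i\<close> in \<open>(\<sigma>\<^sub>2\<^sup>a, \<sigma>\<^sub>2\<^sup>b) \<cdot> m\<close>, for \<open>a, b \<in> {0, 1}\<close>, is
  the one of \<open>m\<close> at \<open>\<upsilon>\<^sub>1\<^sup>a \<upsilon>\<^sub>2\<^sup>b (i)\<close>.\<close>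

definition P_cl_action :: "nat \<Rightarrow> nat \<Rightarrow> int \<times> int \<Rightarrow> (nat \<Rightarrow> nat) \<Rightarrow> (nat \<Rightarrow> nat)" where
  "P_cl_action n l = (\<lambda>(a, b). \<lambda>m\<in>P_cl n l. m \<circ> (upsilon1 n ^^ nat a) \<circ> (upsilon2 n ^^ nat b))"

lemma P_cl_action_generators:
  assumes "m \<in> P_cl n l"
  shows "P_cl_action n l (1, 0) m = (\<lambda>i. m (upsilon1 n i))"
    and "P_cl_action n l (0, 1) m = (\<lambda>i. m (upsilon2 n i))"
  using assms by (auto simp: P_cl_action_def)

definition P_cl_poly :: "nat \<Rightarrow> nat \<Rightarrow> nat poly poly" where
  "P_cl_poly n l =
     (\<Sum>m\<in>P_cl n l. monom (monom 1 (m (n - 1) + m n)) (\<Sum>i | i \<le> n - 1 \<and> odd i. m i))"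

end

theory Submission
  imports Defs
begin

text \<open>
  Among the pairs \<open>(a, b)\<close> of natural numbers with \<open>a + b = t\<close>, the signed count with sign
  \<open>(-1)\<^sup>a\<close> is 1 or 0 as \<open>t\<close> is even or odd, which is also the number of pairs with \<open>a = b\<close>.
  Hence, if a comark-preserving involution \<open>p\<close> of the nodes and a transversal \<open>S\<close> of its
  2-element orbits are given, the sum of \<open>(-1)\<close> to the power \<open>\<Sum>\<^bsub>i \<in> S\<^esub> m\<^sub>i\<close> over the weights counts
  the weights fixed by \<open>p\<close>. At \<open>(-1, 1)\<close> and \<open>(1, -1)\<close> the polynomial is such a sum for \<open>\<upsilon>\<^sub>1\<close> and
  \<open>\<upsilon>\<^sub>2\<close>. At \<open>(-1, -1)\<close> it is again a sum for \<open>\<upsilon>\<^sub>2\<close>, with a different transversal, and \<open>\<upsilon>\<^sub>2\<close> is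
  conjugate to \<open>\<upsilon>\<^sub>1 \<upsilon>\<^sub>2\<close> by the comark-preserving transposition \<open>(1, n - 1)\<close>.
\<close>

section \<open>The group of order 2 and its embedding\<close>

lemma cyclic_C2: "cyclic_group (integer_mod_group 2)"
proof -
  have eq: "{0, 1} = range (\<lambda>k :: int. k mod 2)"
  proof (intro equalityI subsetI)
    show "x \<in> range (\<lambda>k :: int. k mod 2)" if "x \<in> {0, 1}" for x
      using that by (intro image_eqI[of _ _ x]) auto
  qed auto
  show ?thesis
    unfolding group.cyclic_group[OF group_integer_mod_group] carrier_C2
  proof
    show "{0, 1} = range (\<lambda>k :: int. 1 [^]\<^bsub>integer_mod_group 2\<^esub> k)"
      using eq by (simp add: int_pow_integer_mod_group)
  qed simp
qed

lemma C2_embedding_mon: "C2_embedding \<in> mon (integer_mod_group 2) complex_units"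
  unfolding mon_def hom_def carrier_C2
  by (auto simp: complex_units_def integer_mod_group_def C2_embedding_def inj_on_def)

section \<open>Signed sums over orbit pairs\<close>

lemma sum_minus_one_power_atMost:
  "(\<Sum>a\<le>t. (-1) ^ a) = (if even t then 1 else 0 :: 'b::comm_ring_1)"
  by (induction t) auto

text \<open>Freeze every coordinate except \<open>i\<close> and \<open>j\<close>, and also
  \<open>t = m i + m j\<close>. On such a fibre \<open>f\<close> is constant and the sign alternates
  with \<open>m i\<close> from 0 to \<open>t\<close>, so only the midpoint of an even
  \<open>t\<close> survives. The factor \<open>f\<close> leaves room for the signs of further
  pairs.\<close>

lemma signed_sum_pair:
  fixes X :: "('a \<Rightarrow> nat) set" and f :: "('a \<Rightarrow> nat) \<Rightarrow> 'b::comm_ring_1"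
  assumes fin: "finite X" and ij: "i \<noteq> j"
    and closed: "\<And>m a b. m \<in> X \<Longrightarrow> a + b = m i + m j \<Longrightarrow> m(i := a, j := b) \<in> X"
    and f: "\<And>m a b. m \<in> X \<Longrightarrow> a + b = m i + m j \<Longrightarrow> f (m(i := a, j := b)) = f m"
  shows "(\<Sum>m\<in>X. (-1) ^ m i * f m) = (\<Sum>m | m \<in> X \<and> m i = m j. f m)"
proof -
  \<comment> \<open>\<open>h\<close> moves everything from \<open>i\<close> to \<open>j\<close>;
    this normal form labels the fibre.\<close>
  define h where "h = (\<lambda>m :: 'a \<Rightarrow> nat. m(i := 0, j := m i + m j))"
  let ?Y = "{m \<in> X. m i = m j}"
  have fibre: "(\<Sum>m | m \<in> X \<and> h m = y. (-1) ^ m i * f m) = (\<Sum>m | m \<in> ?Y \<and> h m = y. f m)"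
    if "y \<in> h ` X" for y
  proof -
    define t where "t = y j"
    \<comment> \<open>\<open>g\<close> parametrises the fibre over \<open>y\<close> by the value at
      \<open>i\<close>; it is used only for \<open>a \<le> t\<close>, where the subtraction is
      exact.\<close>
    define g where "g = (\<lambda>a. y(i := a, j := t - a))"
    have yX: "y \<in> X" and yi: "y i = 0"
      using that closed ij by (auto simp: h_def)
    have gX: "g a \<in> X" "f (g a) = f y" if "a \<le> t" for a
      using closed[OF yX, of a "t - a"] f[OF yX, of a "t - a"] that yi
      by (auto simp: g_def t_def)
    have hg: "h (g a) = y" if "a \<le> t" for a
      using that yi ij by (auto simp: h_def g_def t_def fun_eq_iff)
    have gh: "m = g (m i)" "m i \<le> t" "t = m i + m j" if "h m = y" for m
      using ij by (auto simp: h_def g_def t_def fun_eq_iff simp flip: that)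
    have inj: "inj_on g {..t}"
      using ij by (auto simp: inj_on_def g_def fun_eq_iff split: if_splits)
    have gi: "g a i = a" for a using ij by (simp add: g_def)
    have set1: "{m. m \<in> X \<and> h m = y} = g ` {..t}"
    proof (intro equalityI subsetI)
      fix m assume "m \<in> {m. m \<in> X \<and> h m = y}"
      then have "h m = y" by simp
      from gh(1,2)[OF this] show "m \<in> g ` {..t}" by (metis atMost_iff image_eqI)
    qed (use gX hg in auto)
    have "(\<Sum>m | m \<in> X \<and> h m = y. (-1) ^ m i * f m) = (\<Sum>a\<le>t. (-1) ^ a * f y)"
      unfolding set1 by (subst sum.reindex[OF inj]) (auto simp: gi gX intro!: sum.cong)
    also have "\<dots> = (if even t then f y else 0)"
      by (simp add: sum_minus_one_power_atMost flip: sum_distrib_right)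
    also have "\<dots> = (\<Sum>m | m \<in> ?Y \<and> h m = y. f m)"
    proof (cases "even t")
      case True
      then have gj: "g (t div 2) j = t div 2"
        by (auto simp: g_def elim!: evenE)
      have "{m. m \<in> ?Y \<and> h m = y} = {g (t div 2)}"
      proof (intro equalityI subsetI)
        fix m assume "m \<in> {m. m \<in> ?Y \<and> h m = y}"
        then have hm: "h m = y" and "m i = m j" by auto
        with gh(3)[OF hm] have "m i = t div 2" by simp
        with gh(1)[OF hm] show "m \<in> {g (t div 2)}" by simp
      qed (use gX hg gi gj in auto)
      then show ?thesis using True gX(2)[of "t div 2"] by simp
    next
      case False
      have "m i \<noteq> m j" if "h m = y" for m
        using False gh(3)[OF that] by auto
      then have "{m. m \<in> ?Y \<and> h m = y} = {}" by blast
      then show ?thesis using False by (simp only: if_False sum.empty)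
    qed
    finally show ?thesis .
  qed
  have "(\<Sum>m\<in>X. (-1) ^ m i * f m) = (\<Sum>y\<in>h ` X. \<Sum>m | m \<in> X \<and> h m = y. (-1) ^ m i * f m)"
    by (rule sum.image_gen[OF fin])
  also have "\<dots> = (\<Sum>y\<in>h ` X. \<Sum>m | m \<in> ?Y \<and> h m = y. f m)"
    using fibre by (rule sum.cong[OF refl])
  also have "\<dots> = sum f ?Y"
    using fin by (intro sum.group) auto
  finally show ?thesis .
qed

text \<open>Induction on \<open>S\<close>: \<open>signed_sum_pair\<close> removes the sign of one
  pair \<open>{i, p i}\<close> and restricts \<open>X\<close> to \<open>m i = m (p i)\<close>, which
  is why \<open>X\<close> has to vary. The signs of the other pairs form the factor
  \<open>f\<close>.\<close>

lemma signed_sum_transversal: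
  fixes X :: "('a \<Rightarrow> nat) set"
  assumes "finite S" "finite X" "inj p"
    and "\<And>i. i \<in> S \<Longrightarrow> p i \<notin> S"
    and "\<And>m i a b. m \<in> X \<Longrightarrow> i \<in> S \<Longrightarrow> a + b = m i + m (p i) \<Longrightarrow> m(i := a, p i := b) \<in> X"
  shows "(\<Sum>m\<in>X. (-1) ^ (\<Sum>i\<in>S. m i)) =
         (of_nat (card {m \<in> X. \<forall>i\<in>S. m i = m (p i)}) :: 'b::comm_ring_1)"
  using assms
proof (induction S arbitrary: X rule: finite_induct)
  case (insert i S)
  let ?Y = "{m \<in> X. m i = m (p i)}"
  have sum_upd: "sum (m(i := a, p i := b)) S = sum m S" for m :: "'a \<Rightarrow> nat" and a b
    using insert.hyps insert.prems(3) by (intro sum.cong) auto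
  have "(\<Sum>m\<in>X. (-1) ^ sum m (insert i S)) = (\<Sum>m\<in>X. (-1) ^ m i * (-1) ^ sum m S :: 'b)"
    using insert.hyps by (simp add: power_add)
  also have "\<dots> = (\<Sum>m\<in>?Y. (-1) ^ sum m S)"
  proof (rule signed_sum_pair)
    show "i \<noteq> p i" using insert.prems(3)[of i] by auto
    show "m(i := a, p i := b) \<in> X" if "m \<in> X" "a + b = m i + m (p i)" for m a b
      using that(1) insertI1 that(2) by (rule insert.prems(4))
  qed (use insert.prems sum_upd in auto)
  also have "\<dots> = of_nat (card {m \<in> ?Y. \<forall>i\<in>S. m i = m (p i)})"
  proof (rule insert.IH)
    fix m k a b
    assume *: "m \<in> ?Y" "k \<in> S" "a + b = m k + m (p k)"
    \<comment> \<open>The two pairs are disjoint, since \<open>p\<close> is injective and maps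
      \<open>S\<close> off \<open>S\<close>; redistribution on one therefore keeps the equation on
      the other.\<close>
    then have "i \<noteq> k" "i \<noteq> p k" "p i \<noteq> k" "p i \<noteq> p k"
      using insert.hyps insert.prems(2,3) by (auto dest: injD)
    moreover have "m(k := a, p k := b) \<in> X"
      by (rule insert.prems(4)) (use * in simp_all)
    ultimately show "m(k := a, p k := b) \<in> ?Y" using * by simp
  qed (use insert.prems in auto)
  also have "{m \<in> ?Y. \<forall>i\<in>S. m i = m (p i)} = {m \<in> X. \<forall>i\<in>insert i S. m i = m (p i)}"
    by auto
  finally show ?case .
qed simp

section \<open>Weights of fixed level\<close>

text \<open>Comarks are at least 1, so the level bounds every coefficient.\<close>

lemma finite_P_cl: "finite (P_cl n l)"
proof (rule finite_subset)
  show "P_cl n l \<subseteq> {m. \<forall>i. (i \<in> {0..n} \<longrightarrow> m i \<in> {0..l}) \<and> (i \<notin> {0..n} \<longrightarrow> m i = 0)}"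
  proof safe
    fix m i assume m: "m \<in> P_cl n l"
    show "m i \<in> {0..l}" if "i \<in> {0..n}"
    proof -
      have "m i \<le> comark n i * m i" by (simp add: comark_def)
      also have "\<dots> \<le> (\<Sum>i=0..n. comark n i * m i)"
        using that by (intro member_le_sum) auto
      finally show ?thesis using m by (simp add: P_cl_def)
    qed
    show "m i = 0" if "i \<notin> {0..n}" using m that by (simp add: P_cl_def)
  qed
qed (rule finite_set_of_finite_funs; simp)

text \<open>With equal comarks, the level sees \<open>m i\<close> and \<open>m j\<close> only
  through their sum.\<close>

lemma P_cl_update_pair:
  assumes "m \<in> P_cl n l" "i \<le> n" "j \<le> n" "i \<noteq> j" "comark n i = comark n j"
    and "a + b = m i + m j"
  shows "m(i := a, j := b) \<in> P_cl n l"
proof -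
  have split: "(\<Sum>k=0..n. comark n k * m' k) =
      comark n i * (m' i + m' j) + (\<Sum>k\<in>{0..n} - {i, j}. comark n k * m' k)" for m'
  proof -
    have "{0..n} = insert i (insert j ({0..n} - {i, j}))" using assms by auto
    then have "(\<Sum>k=0..n. comark n k * m' k) =
        (\<Sum>k\<in>insert i (insert j ({0..n} - {i, j})). comark n k * m' k)" by simp
    then show ?thesis using assms(4,5) by (simp add: algebra_simps)
  qed
  show ?thesis
    using assms split[of m] split[of "m(i := a, j := b)"] by (simp add: P_cl_def)
qed

lemma P_cl_comp:
  assumes "m \<in> P_cl n l" "p permutes {0..n}" "\<And>i. comark n (p i) = comark n i"
  shows "m \<circ> p \<in> P_cl n l"
proof -
  have "(\<Sum>i=0..n. comark n i * m (p i)) = (\<Sum>i=0..n. comark n (p i) * m (p i))"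
    by (simp add: assms(3))
  also have "\<dots> = (\<Sum>i=0..n. comark n i * m i)"
    using sum.permute[OF assms(2), of "\<lambda>i. comark n i * m i"] by (simp add: o_def)
  finally show ?thesis
    using assms(1) permutes_not_in[OF assms(2)] by (auto simp: P_cl_def)
qed

text \<open>The hypotheses on \<open>S\<close> say that it picks one node from each 2-element orbit
  of \<open>p\<close>. Invariance of the comarks keeps the level fixed when weight moves inside an
  orbit.\<close>

lemma signed_sum_P_cl:
  assumes inv: "\<And>i. p (p i) = i" and perm: "p permutes {0..n}"
    and comark: "\<And>i. comark n (p i) = comark n i"
    and S: "S \<subseteq> {0..n}" "\<And>i. i \<in> S \<Longrightarrow> p i \<notin> S"
    and fixed: "\<And>i. i \<notin> S \<Longrightarrow> p i \<notin> S \<Longrightarrow> p i = i"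
  shows "(\<Sum>m\<in>P_cl n l. (-1) ^ (\<Sum>i\<in>S. m i)) =
         (of_nat (card {m \<in> P_cl n l. m \<circ> p = m}) :: 'b::comm_ring_1)"
proof -
  have "(\<Sum>m\<in>P_cl n l. (-1) ^ (\<Sum>i\<in>S. m i)) =
      (of_nat (card {m \<in> P_cl n l. \<forall>i\<in>S. m i = m (p i)}) :: 'b)"
  proof (rule signed_sum_transversal)
    fix m i a b
    assume *: "m \<in> P_cl n l" "i \<in> S" "a + b = m i + m (p i)"
    have "p i \<le> n" using permutes_in_image[OF perm, of i] * S by auto
    then show "m(i := a, p i := b) \<in> P_cl n l"
      using * S comark by (intro P_cl_update_pair) (auto, metis)
  qed (use S finite_P_cl perm in \<open>auto simp: finite_subset permutes_inj\<close>)
  also have "{m \<in> P_cl n l. \<forall>i\<in>S. m i = m (p i)} = {m \<in> P_cl n l. m \<circ> p = m}"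
  proof (intro Collect_cong conj_cong refl iffI)
    fix m :: "nat \<Rightarrow> nat"
    assume *: "\<forall>i\<in>S. m i = m (p i)"
    \<comment> \<open>Either \<open>i\<close> is in \<open>S\<close>, or \<open>p i\<close> is and
      the involution swaps the roles, or \<open>p i = i\<close>.\<close>
    have "m (p i) = m i" for i
      using * fixed[of i] inv[of i] by metis
    then show "m \<circ> p = m" by auto
  next
    fix m :: "nat \<Rightarrow> nat"
    assume "m \<circ> p = m"
    then show "\<forall>i\<in>S. m i = m (p i)" by (metis comp_apply)
  qed
  finally show ?thesis .
qed

section \<open>Products of transpositions, involutions\<close>

lemma foldr_adjacent_transpositions:
  "foldr (\<lambda>j p. transpose (2 * j) (Suc (2 * j)) \<circ> p) [0..<k] b i =
    (if b i < 2 * k then if even (b i) then b i + 1 else b i - 1 else b i)" for b :: "nat \<Rightarrow> nat"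
\<comment> \<open>The last factor of the list acts directly after \<open>b\<close>, so the induction
  step changes the starting function.\<close>
proof (induction k arbitrary: b)
  case (Suc k)
  have "foldr (\<lambda>j p. transpose (2 * j) (Suc (2 * j)) \<circ> p) [0..<Suc k] b i =
      foldr (\<lambda>j p. transpose (2 * j) (Suc (2 * j)) \<circ> p) [0..<k]
        (transpose (2 * k) (Suc (2 * k)) \<circ> b) i"
    by simp
  note * = this[unfolded Suc.IH]
  consider "b i < 2 * k" | "b i = 2 * k" | "b i = 2 * k + 1" | "b i > 2 * k + 1" by linarith
  then show ?case unfolding * by cases (auto simp: transpose_def)
qed simp

lemma involution_permutes:
  assumes "\<And>i. p (p i) = i" "\<And>i. i \<notin> A \<Longrightarrow> p i = i"
  shows "p permutes A"
  unfolding permutes_def using assms by metis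

section \<open>Evaluation of polynomials in two variables\<close>

lemma poly2_add: "poly2 (P + Q) x y = poly2 P x y + poly2 Q x y"
proof -
  have 1: "map_poly of_nat (p + q) = (map_poly of_nat p + map_poly of_nat q :: complex poly)"
    for p q
    by (rule poly_eqI) (simp add: coeff_map_poly)
  have "map_poly (\<lambda>p. poly (map_poly of_nat p) x) (P + Q) =
      map_poly (\<lambda>p. poly (map_poly of_nat p) x) P + map_poly (\<lambda>p. poly (map_poly of_nat p) x) Q"
    by (rule poly_eqI) (simp add: coeff_map_poly 1)
  then show ?thesis by (simp add: poly2_def)
qed

lemma poly2_sum: "poly2 (\<Sum>a\<in>A. P a) x y = (\<Sum>a\<in>A. poly2 (P a) x y)"
proof (induction A rule: infinite_finite_induct)
  case (insert a A)
  then show ?case by (simp add: poly2_add)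
qed (simp_all add: poly2_def)

lemma poly2_monom: "poly2 (monom (monom 1 a) b) x y = x ^ a * y ^ b"
  by (simp add: poly2_def map_poly_monom poly_monom)

lemma poly2_P_cl_poly:
  "poly2 (P_cl_poly n l) x y =
    (\<Sum>m\<in>P_cl n l. x ^ (m (n - 1) + m n) * y ^ (\<Sum>i | i \<le> n - 1 \<and> odd i. m i))"
  unfolding P_cl_poly_def poly2_sum poly2_monom ..

section \<open>The two diagram permutations\<close>

text \<open>The even \<open>n\<close> is written \<open>2 * k + 4\<close> from here on, to keep truncated subtraction out of the
  indices \<open>n - 1\<close> and \<open>n - 2\<close>.\<close>

lemma comark_eq: "comark (2 * k + 4) i = (if i \<in> {0, 1, 2 * k + 3, 2 * k + 4} then 1 else 2)"
  by (simp add: comark_def)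

lemma upsilon1_eq: "upsilon1 (2 * k + 4) = transpose 0 (2 * k + 4) \<circ> transpose 1 (2 * k + 3)"
  by (simp add: upsilon1_def add.commute)

lemma upsilon1_ends:
  "upsilon1 (2 * k + 4) 0 = 2 * k + 4" "upsilon1 (2 * k + 4) (2 * k + 4) = 0"
  "upsilon1 (2 * k + 4) (Suc 0) = 2 * k + 3" "upsilon1 (2 * k + 4) (2 * k + 3) = Suc 0"
  by (simp_all add: upsilon1_eq transpose_def)

lemma upsilon1_other:
  "i \<noteq> 0 \<Longrightarrow> i \<noteq> Suc 0 \<Longrightarrow> i \<noteq> 2 * k + 3 \<Longrightarrow> i \<noteq> 2 * k + 4 \<Longrightarrow> upsilon1 (2 * k + 4) i = i"
  by (simp add: upsilon1_eq transpose_def)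

lemma upsilon2_eq:
  "upsilon2 (2 * k + 4) i = (let j = transpose (2 * k + 3) (2 * k + 4) i
    in if j < 2 * k + 2 then if even j then j + 1 else j - 1 else j)"
proof -
  \<comment> \<open>The \<open>k + 1\<close> factors pair up the nodes below
    \<open>2 * k + 2\<close>; the node \<open>2 * k + 2\<close>, that is \<open>n - 2\<close>, stays
    fixed.\<close>
  have k: "(2 * k + 4 - 2) div 2 = k + 1" by simp
  have pred: "2 * k + 4 - 1 = 2 * k + 3" by simp
  show ?thesis
    unfolding upsilon2_def k pred Suc_eq_plus1[symmetric] foldr_adjacent_transpositions Let_def
    by simp
qed

lemma upsilon2_even: "j \<le> k \<Longrightarrow> upsilon2 (2 * k + 4) (2 * j) = Suc (2 * j)"
  and upsilon2_odd: "j \<le> k \<Longrightarrow> upsilon2 (2 * k + 4) (Suc (2 * j)) = 2 * j"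
  and upsilon2_ends: "upsilon2 (2 * k + 4) (2 * k + 3) = 2 * k + 4"
    "upsilon2 (2 * k + 4) (2 * k + 4) = 2 * k + 3"
  and upsilon2_other: "i = 2 * k + 2 \<or> i > 2 * k + 4 \<Longrightarrow> upsilon2 (2 * k + 4) i = i"
  by (auto simp: upsilon2_eq transpose_def)

text \<open>The instances at 0 serve the nodes \<open>0\<close> and \<open>Suc 0\<close>, which do
  not match the pattern \<open>2 * j\<close> syntactically.\<close>

lemmas upsilon2_simps = upsilon2_even upsilon2_odd upsilon2_ends upsilon2_other
  upsilon2_even[of 0, simplified] upsilon2_odd[of 0, simplified]

text \<open>The cases follow the orbits of \<open>upsilon2\<close>: the pairs \<open>2 * j\<close>,
  \<open>Suc (2 * j)\<close>, the fixed node \<open>2 * k + 2\<close>, and the end pair.\<close>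

lemma node_cases:
  fixes i k :: nat
  obtains (even) j where "i = 2 * j" "j \<le> k" | (odd) j where "i = Suc (2 * j)" "j \<le> k"
  | (last) "i = 2 * k + 2" | (left) "i = 2 * k + 3" | (right) "i = 2 * k + 4"
  | (out) "i > 2 * k + 4"
proof -
  consider "i < 2 * k + 2" | "i = 2 * k + 2" | "i = 2 * k + 3" | "i = 2 * k + 4" | "i > 2 * k + 4"
    by linarith
  then show thesis
  proof cases
    case 1
    show thesis
    proof (cases "even i")
      case True
      with 1 show thesis by (elim evenE) (auto intro: that(1))
    next
      case False
      with 1 show thesis by (elim oddE) (auto intro: that(2))
    qed
  qed (use that in auto)
qed

lemma upsilon1_involution: "upsilon1 (2 * k + 4) (upsilon1 (2 * k + 4) i) = i"
  by (cases "i \<in> {0, Suc 0, 2 * k + 3, 2 * k + 4}") (auto simp: upsilon1_ends upsilon1_other)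

lemma upsilon2_involution: "upsilon2 (2 * k + 4) (upsilon2 (2 * k + 4) i) = i"
  by (cases rule: node_cases[of i k]) (simp_all add: upsilon2_simps)

lemma upsilon1_permutes: "upsilon1 (2 * k + 4) permutes {0..2 * k + 4}"
  unfolding upsilon1_eq by (intro permutes_compose permutes_swap_id) auto

lemma upsilon2_permutes: "upsilon2 (2 * k + 4) permutes {0..2 * k + 4}"
  by (intro involution_permutes upsilon2_involution upsilon2_other) simp

text \<open>On the four end nodes both sides are \<open>(0, n-1)(1, n)\<close>; on all other nodes
  both agree with \<open>upsilon2\<close>.\<close>

lemma upsilon_conjugate:
  "upsilon1 (2 * k + 4) \<circ> upsilon2 (2 * k + 4) =
    transpose 1 (2 * k + 3) \<circ> upsilon2 (2 * k + 4) \<circ> transpose 1 (2 * k + 3)"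
proof
  fix i
  show "(upsilon1 (2 * k + 4) \<circ> upsilon2 (2 * k + 4)) i =
    (transpose 1 (2 * k + 3) \<circ> upsilon2 (2 * k + 4) \<circ> transpose 1 (2 * k + 3)) i"
  proof (cases rule: node_cases[of i k])
    case (even j)
    then show ?thesis
      \<comment> \<open>Among these pairs only \<open>{0, 1}\<close> meets the end nodes moved by
        \<open>upsilon1\<close>.\<close>
      by (cases "j = 0") (simp_all add: upsilon2_simps upsilon1_ends upsilon1_other transpose_def)
  next
    case (odd j)
    then show ?thesis
      by (cases "j = 0") (simp_all add: upsilon2_simps upsilon1_ends upsilon1_other transpose_def)
  qed (simp_all add: upsilon2_simps upsilon1_ends upsilon1_other transpose_def)
qed

lemma upsilon_commute:
  "upsilon1 (2 * k + 4) \<circ> upsilon2 (2 * k + 4) = upsilon2 (2 * k + 4) \<circ> upsilon1 (2 * k + 4)"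
proof
  fix i
  show "(upsilon1 (2 * k + 4) \<circ> upsilon2 (2 * k + 4)) i =
    (upsilon2 (2 * k + 4) \<circ> upsilon1 (2 * k + 4)) i"
  proof (cases rule: node_cases[of i k])
    case (even j)
    then show ?thesis
      by (cases "j = 0") (simp_all add: upsilon2_simps upsilon1_ends upsilon1_other)
  next
    case (odd j)
    then show ?thesis
      by (cases "j = 0") (simp_all add: upsilon2_simps upsilon1_ends upsilon1_other)
  qed (simp_all add: upsilon2_simps upsilon1_ends upsilon1_other)
qed

lemma comark_upsilon1: "comark (2 * k + 4) (upsilon1 (2 * k + 4) i) = comark (2 * k + 4) i"
  by (cases "i \<in> {0, Suc 0, 2 * k + 3, 2 * k + 4}")
    (auto simp: comark_eq upsilon1_ends upsilon1_other)

lemma comark_upsilon2: "comark (2 * k + 4) (upsilon2 (2 * k + 4) i) = comark (2 * k + 4) i"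
  by (cases rule: node_cases[of i k]) (auto simp: comark_eq upsilon2_simps)

lemma comark_transpose:
  "comark (2 * k + 4) (transpose 1 (2 * k + 3) i) = comark (2 * k + 4) i"
  by (simp add: comark_eq transpose_def)

section \<open>The action on weights\<close>

lemma P_cl_comp_upsilon:
  assumes "m \<in> P_cl (2 * k + 4) l"
  shows "m \<circ> upsilon1 (2 * k + 4) \<in> P_cl (2 * k + 4) l"
    and "m \<circ> upsilon2 (2 * k + 4) \<in> P_cl (2 * k + 4) l"
  using assms
  by (auto intro: P_cl_comp upsilon1_permutes upsilon2_permutes comark_upsilon1 comark_upsilon2)

lemma P_cl_action_closed:
  assumes "m \<in> P_cl (2 * k + 4) l" "a \<in> {0, 1}" "b \<in> {0, 1}"
  shows "P_cl_action (2 * k + 4) l (a, b) m \<in> P_cl (2 * k + 4) l"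
  using assms by (auto simp: P_cl_action_def intro!: P_cl_comp_upsilon)

text \<open>Commutation lets the powers of each permutation be collected, and the involution
  property absorbs the reduction mod 2.\<close>

lemma P_cl_action_mult:
  assumes "m \<in> P_cl (2 * k + 4) l" "a \<in> {0, 1}" "b \<in> {0, 1}" "c \<in> {0, 1}" "d \<in> {0, 1}"
  shows "P_cl_action (2 * k + 4) l ((a + c) mod 2, (b + d) mod 2) m =
    P_cl_action (2 * k + 4) l (a, b) (P_cl_action (2 * k + 4) l (c, d) m)"
proof -
  let ?n = "2 * k + 4"
  have comm: "upsilon2 ?n (upsilon1 ?n i) = upsilon1 ?n (upsilon2 ?n i)" for i
    using upsilon_commute by (metis comp_apply)
  have "P_cl_action ?n l (a, b) (P_cl_action ?n l (c, d) m) =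
      P_cl_action ?n l (c, d) m \<circ> (upsilon1 ?n ^^ nat a) \<circ> (upsilon2 ?n ^^ nat b)"
    using P_cl_action_closed[OF assms(1,4,5)] by (simp add: P_cl_action_def)
  then show ?thesis
    using assms
    by (auto simp: P_cl_action_def fun_eq_iff comm upsilon1_involution upsilon2_involution)
qed

lemma P_cl_group_action:
  "group_action (integer_mod_group 2 \<times>\<times> integer_mod_group 2)
    (P_cl (2 * k + 4) l) (P_cl_action (2 * k + 4) l)"
proof -
  let ?G = "integer_mod_group 2 \<times>\<times> integer_mod_group 2"
  let ?X = "P_cl (2 * k + 4) l" and ?\<phi> = "P_cl_action (2 * k + 4) l"
  have carrier: "carrier ?G = {0, 1} \<times> {0, 1}"
    by (simp add: carrier_C2)
  have bij: "?\<phi> g \<in> Bij ?X" if g_carrier: "g \<in> carrier ?G" for g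
  proof -
    obtain a b where g: "g = (a, b)" and ab: "a \<in> {0, 1}" "b \<in> {0, 1}"
      using g_carrier unfolding carrier by blast
    \<comment> \<open>Every group element has order at most 2, so its action is its own
      inverse.\<close>
    have inv: "?\<phi> g (?\<phi> g m) = m" if "m \<in> ?X" for m
      using P_cl_action_mult[OF that ab ab] ab that unfolding g
      by (auto simp: P_cl_action_def)
    have closed: "?\<phi> g ` ?X \<subseteq> ?X"
      using P_cl_action_closed[OF _ ab] unfolding g by blast
    have "bij_betw (?\<phi> g) ?X ?X"
      by (rule bij_betw_byWitness[of _ "?\<phi> g"]) (use inv closed in blast)+
    moreover have "?\<phi> g \<in> extensional ?X"
      by (simp add: g P_cl_action_def)
    ultimately show ?thesis by (simp add: Bij_def)
  qed
  have "?\<phi> (g \<otimes>\<^bsub>?G\<^esub> h) = compose ?X (?\<phi> g) (?\<phi> h)"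
    if gh: "g \<in> carrier ?G" "h \<in> carrier ?G" for g h
  proof (rule extensionalityI)
    show "?\<phi> (g \<otimes>\<^bsub>?G\<^esub> h) \<in> extensional ?X"
      by (simp add: P_cl_action_def split: prod.splits)
    show "?\<phi> (g \<otimes>\<^bsub>?G\<^esub> h) m = compose ?X (?\<phi> g) (?\<phi> h) m" if "m \<in> ?X" for m
      using gh that unfolding carrier
      by (auto simp: compose_eq integer_mod_group_def simp flip: P_cl_action_mult)
  qed simp
  then show ?thesis
    unfolding group_action_def group_hom_def group_hom_axioms_def
    using bij
    by (auto simp: hom_def BijGroup_def DirProd_group group_BijGroup[unfolded BijGroup_def])
qed

section \<open>Signed counts of fixed weights\<close>

lemma P_cl_comp_transpose:
  "m \<in> P_cl (2 * k + 4) l \<Longrightarrow> m \<circ> transpose 1 (2 * k + 3) \<in> P_cl (2 * k + 4) l"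
  by (intro P_cl_comp permutes_swap_id comark_transpose) simp_all

text \<open>If \<open>u = t v t\<close> with \<open>t\<close> an involution, composition with
  \<open>t\<close> exchanges the weights fixed by \<open>u\<close> and those fixed by
  \<open>v\<close>.\<close>

lemma card_fixed_conjugate:
  "card {m \<in> P_cl (2 * k + 4) l. m \<circ> (upsilon1 (2 * k + 4) \<circ> upsilon2 (2 * k + 4)) = m} =
   card {m \<in> P_cl (2 * k + 4) l. m \<circ> upsilon2 (2 * k + 4) = m}"
proof (rule bij_betw_same_card)
  let ?t = "transpose 1 (2 * k + 3) :: nat \<Rightarrow> nat"
  let ?u = "upsilon1 (2 * k + 4) \<circ> upsilon2 (2 * k + 4)" and ?v = "upsilon2 (2 * k + 4)"
  have tt: "m \<circ> ?t \<circ> ?t = m" for m :: "nat \<Rightarrow> nat" by (simp add: o_assoc[symmetric])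
  have iff: "m \<circ> ?u = m \<longleftrightarrow> m \<circ> ?t \<circ> ?v = m \<circ> ?t" for m :: "nat \<Rightarrow> nat"
  proof -
    have eq: "m \<circ> ?u = m \<circ> ?t \<circ> ?v \<circ> ?t"
      unfolding upsilon_conjugate by (simp only: o_assoc)
    show ?thesis
    proof
      assume "m \<circ> ?u = m"
      then have "m \<circ> ?t \<circ> ?v \<circ> ?t \<circ> ?t = m \<circ> ?t" by (simp only: eq)
      then show "m \<circ> ?t \<circ> ?v = m \<circ> ?t" by (simp only: tt)
    qed (simp only: eq tt)
  qed
  show "bij_betw (\<lambda>m. m \<circ> ?t) {m \<in> P_cl (2 * k + 4) l. m \<circ> ?u = m}
      {m \<in> P_cl (2 * k + 4) l. m \<circ> ?v = m}"
    by (rule bij_betw_byWitness[where f' = "\<lambda>m. m \<circ> ?t"])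
      (auto simp: iff tt intro: P_cl_comp_transpose simp del: One_nat_def)
qed

lemma signed_sum_upsilon1:
  "(\<Sum>m\<in>P_cl (2 * k + 4) l. (-1) ^ (m (2 * k + 3) + m (2 * k + 4))) =
    (of_nat (card {m \<in> P_cl (2 * k + 4) l. m \<circ> upsilon1 (2 * k + 4) = m}) :: 'b::comm_ring_1)"
proof -
  \<comment> \<open>One node from each of the orbits \<open>{1, n-1}\<close> and
    \<open>{0, n}\<close>.\<close>
  let ?S = "{2 * k + 3, 2 * k + 4}"
  have "(\<Sum>m\<in>P_cl (2 * k + 4) l. (-1) ^ (\<Sum>i\<in>?S. m i)) =
    (of_nat (card {m \<in> P_cl (2 * k + 4) l. m \<circ> upsilon1 (2 * k + 4) = m}) :: 'b)"
  proof (rule signed_sum_P_cl)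
    fix i
    show "i \<in> ?S \<Longrightarrow> upsilon1 (2 * k + 4) i \<notin> ?S"
      by (auto simp: upsilon1_ends)
    show "i \<notin> ?S \<Longrightarrow> upsilon1 (2 * k + 4) i \<notin> ?S \<Longrightarrow> upsilon1 (2 * k + 4) i = i"
      by (cases "i \<in> {0, Suc 0}") (auto simp: upsilon1_ends upsilon1_other)
  qed (use upsilon1_involution upsilon1_permutes comark_upsilon1 in auto)
  then show ?thesis by simp
qed

text \<open>The odd nodes meet each pair \<open>{2j, 2j+1}\<close> once and contribute
  \<open>n - 1\<close> from \<open>{n-1, n}\<close>; the fixed node \<open>n - 2\<close> is
  even.\<close>

lemma signed_sum_upsilon2:
  "(\<Sum>m\<in>P_cl (2 * k + 4) l. (-1) ^ (\<Sum>i | i \<le> 2 * k + 3 \<and> odd i. m i)) =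
    (of_nat (card {m \<in> P_cl (2 * k + 4) l. m \<circ> upsilon2 (2 * k + 4) = m}) :: 'b::comm_ring_1)"
proof (rule signed_sum_P_cl)
  let ?S = "{i. i \<le> 2 * k + 3 \<and> odd i}"
  fix i
  show "i \<in> ?S \<Longrightarrow> upsilon2 (2 * k + 4) i \<notin> ?S"
    by (cases rule: node_cases[of i k]) (simp_all add: upsilon2_simps)
  show "i \<notin> ?S \<Longrightarrow> upsilon2 (2 * k + 4) i \<notin> ?S \<Longrightarrow> upsilon2 (2 * k + 4) i = i"
    by (cases rule: node_cases[of i k]) (simp_all add: upsilon2_simps)
qed (use upsilon2_involution upsilon2_permutes comark_upsilon2 in auto)

text \<open>The coefficient at \<open>n - 1\<close> occurs in both exponents and cancels mod 2. What
  remains is the transversal of \<open>upsilon2\<close> in which \<open>n\<close> replaces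
  \<open>n - 1\<close>.\<close>

lemma signed_sum_upsilon1_upsilon2:
  "(\<Sum>m\<in>P_cl (2 * k + 4) l.
      (-1) ^ (m (2 * k + 3) + m (2 * k + 4)) * (-1) ^ (\<Sum>i | i \<le> 2 * k + 3 \<and> odd i. m i)) =
    (of_nat (card {m \<in> P_cl (2 * k + 4) l.
      m \<circ> (upsilon1 (2 * k + 4) \<circ> upsilon2 (2 * k + 4)) = m}) :: 'b::comm_ring_1)"
proof -
  let ?odd = "{i. i < 2 * k + 3 \<and> odd i}"
  let ?S = "insert (2 * k + 4) ?odd"
  have odds: "{i. i \<le> 2 * k + 3 \<and> odd i} = insert (2 * k + 3) ?odd"
    by auto
  have sign: "(-1) ^ (m (2 * k + 3) + m (2 * k + 4)) *
        (-1) ^ (\<Sum>i | i \<le> 2 * k + 3 \<and> odd i. m i) =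
      ((-1) ^ (\<Sum>i\<in>?S. m i) :: 'b)" for m :: "nat \<Rightarrow> nat"
  proof -
    have "(\<Sum>i | i \<le> 2 * k + 3 \<and> odd i. m i) = m (2 * k + 3) + sum m ?odd"
      unfolding odds by simp
    moreover have "sum m ?S = m (2 * k + 4) + sum m ?odd"
      by simp
    ultimately have "m (2 * k + 3) + m (2 * k + 4) + (\<Sum>i | i \<le> 2 * k + 3 \<and> odd i. m i) =
        2 * m (2 * k + 3) + sum m ?S"
      by linarith
    then show ?thesis
      unfolding power_add[symmetric] by (simp only: power_add power_minus1_even mult_1)
  qed
  have "(\<Sum>m\<in>P_cl (2 * k + 4) l. (-1) ^ (\<Sum>i\<in>?S. m i)) =
      (of_nat (card {m \<in> P_cl (2 * k + 4) l. m \<circ> upsilon2 (2 * k + 4) = m}) :: 'b)"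
  proof (rule signed_sum_P_cl)
    fix i
    show "i \<in> ?S \<Longrightarrow> upsilon2 (2 * k + 4) i \<notin> ?S"
      by (cases rule: node_cases[of i k]) (simp_all add: upsilon2_simps)
    show "i \<notin> ?S \<Longrightarrow> upsilon2 (2 * k + 4) i \<notin> ?S \<Longrightarrow> upsilon2 (2 * k + 4) i = i"
      by (cases rule: node_cases[of i k]) (simp_all add: upsilon2_simps)
  qed (use upsilon2_involution upsilon2_permutes comark_upsilon2 in auto)
  then show ?thesis
    by (simp only: sign card_fixed_conjugate)
qed

section \<open>Sieving at the four group elements\<close>

lemma bicyclic_sieving_P_cl:
  "bicyclic_sieving (integer_mod_group 2) (integer_mod_group 2) C2_embedding C2_embedding
    (P_cl (2 * k + 4) l) (P_cl_action (2 * k + 4) l) (P_cl_poly (2 * k + 4) l)"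
proof -
  have pred: "2 * k + 4 - 1 = 2 * k + 3" by simp
  have inv: "invariants (P_cl n l) (P_cl_action n l) (a, b) =
      {m \<in> P_cl n l. m \<circ> ((upsilon1 n ^^ nat a) \<circ> (upsilon2 n ^^ nat b)) = m}" for n a b
    by (auto simp: invariants_def P_cl_action_def o_assoc)
  have "poly2 (P_cl_poly (2 * k + 4) l) (C2_embedding a) (C2_embedding b) =
      of_nat (card (invariants (P_cl (2 * k + 4) l) (P_cl_action (2 * k + 4) l) (a, b)))"
    if ab: "a \<in> {0, 1}" "b \<in> {0, 1}" for a b
  proof -
    \<comment> \<open>At the identity all signs are 1 and both sides count all weights; the other
      three cases are the signed sums.\<close>
    consider "a = 0" "b = 0" | "a = 1" "b = 0" | "a = 0" "b = 1" | "a = 1" "b = 1"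
      using ab by auto
    then show ?thesis
      unfolding inv poly2_P_cl_poly pred
      by cases (simp_all add: C2_embedding_def signed_sum_upsilon1 signed_sum_upsilon2
        signed_sum_upsilon1_upsilon2)
  qed
  then show ?thesis
    by (simp add: bicyclic_sieving_def carrier_C2 finite_P_cl cyclic_C2 C2_embedding_mon
      P_cl_group_action)
qed

theorem theorem5p3:
  fixes n l :: nat
  assumes "n \<ge> 4" and "even n"
  shows "upsilon1 n permutes {0..n} \<and> upsilon2 n permutes {0..n} \<and>
         upsilon1 n \<circ> upsilon2 n = upsilon2 n \<circ> upsilon1 n \<and>
         bicyclic_sieving (integer_mod_group 2) (integer_mod_group 2) C2_embedding C2_embedding
           (P_cl n l) (P_cl_action n l) (P_cl_poly n l)"
proof -
  obtain j where "n = 2 * j" using \<open>even n\<close> by (elim evenE)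
  \<comment> \<open>\<open>n \<ge> 4\<close> gives \<open>j \<ge> 2\<close>, so \<open>j - 2\<close>
    is not truncated.\<close>
  then obtain k where k: "n = 2 * k + 4" using \<open>n \<ge> 4\<close> by (intro that[of "j - 2"]) simp
  show ?thesis
    unfolding k
    by (intro conjI upsilon1_permutes upsilon2_permutes upsilon_commute bicyclic_sieving_P_cl)
qed

end
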